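(* Let $k$ be any positive integer, and let $L$ be a $2k\times 2k$ cyclic Latin square on symbols $1,2,\dots,2k$, with rows and columns indexed by $1,2,\dots,2k$. Construct an array $A$ from $L$ as follows: in each row $i$ of $L$, for the positions $(i-1)k-(i-2),\ \ldots,\ ik-(i-1)$, taken modulo $2k$, if the symbol in a position is $s$, replace it with a new symbol $s'$. Then $A$ is a $(4k, k, -, -, k : 2k\times 2k)$ AO-array.
   Context: A cyclic Latin square is a Latin square that is a group table of the cyclic group. The symbols $1',\dots,(2k)'$ are distinct from each other and from $1,\dots,2k$. A $(v, e, -, -, \lambda_{rc} : r \times c)$ AO-array (adjusted orthogonal array) is an $r\times c$ array on $v$ symbols such that no symbol occurs more than once in any row or any column, every symbol occurs exactly $e$ times in the array, and every row and every column have exactly $\lambda_{rc}$ common symbols. *)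

theory Defs
  imports "HOL-Algebra.Elementary_Groups" "HOL-Number_Theory.Cong"
begin

text \<open>An \<open>r \<times> c\<close> array is a function of a row index in \<open>{1..r}\<close> and a column index in
  \<open>{1..c}\<close>; its values elsewhere are irrelevant.\<close>

definition latin_square :: "nat \<Rightarrow> 'a set \<Rightarrow> (nat \<Rightarrow> nat \<Rightarrow> 'a) \<Rightarrow> bool" where
  "latin_square n S L \<longleftrightarrow>
     (\<forall>i\<in>{1..n}. bij_betw (\<lambda>j. L i j) {1..n} S) \<and>
     (\<forall>j\<in>{1..n}. bij_betw (\<lambda>i. L i j) {1..n} S)"

text \<open>The rows are headed \<open>x 1, \<dots>, x n\<close>, the columns \<open>y 1, \<dots>, y n\<close>, and \<open>\<phi>\<close> is the symbol
  by which a group element is written.\<close>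

definition group_table ::
  "('g, 'b) monoid_scheme \<Rightarrow> nat \<Rightarrow> 'a set \<Rightarrow> (nat \<Rightarrow> 'g) \<Rightarrow> (nat \<Rightarrow> 'g) \<Rightarrow> ('g \<Rightarrow> 'a)
     \<Rightarrow> (nat \<Rightarrow> nat \<Rightarrow> 'a) \<Rightarrow> bool" where
  "group_table G n S x y \<phi> L \<longleftrightarrow>
     bij_betw x {1..n} (carrier G) \<and> bij_betw y {1..n} (carrier G) \<and> bij_betw \<phi> (carrier G) S \<and>
     (\<forall>i\<in>{1..n}. \<forall>j\<in>{1..n}. L i j = \<phi> (x i \<otimes>\<^bsub>G\<^esub> y j))"

text \<open>The cyclic group is listed in its cyclic order \<open>1, a, a\<^sup>2, \<dots>\<close> along both the rows and the
  columns, for some generator \<open>a\<close> (that \<open>a\<close> generates is forced by the bijectivity of the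
  headings), so each row is the cyclic left shift of the preceding one.  The naming of the group
  elements by symbols is arbitrary; this also covers headings that start at an element other than
  the identity.  With headings in arbitrary order the notion would depend only on the isotopy
  class, and positional constructions on the square would not be meaningful.\<close>

definition cyclic_latin_square :: "nat \<Rightarrow> 'a set \<Rightarrow> (nat \<Rightarrow> nat \<Rightarrow> 'a) \<Rightarrow> bool" where
  "cyclic_latin_square n S L \<longleftrightarrow>
     latin_square n S L \<and>
     (\<exists>a \<in> carrier (integer_mod_group n). \<exists>\<phi>.
        group_table (integer_mod_group n) n S
          (\<lambda>i. a [^]\<^bsub>integer_mod_group n\<^esub> (i - 1))
          (\<lambda>j. a [^]\<^bsub>integer_mod_group n\<^esub> (j - 1)) \<phi> L)"

text \<open>A \<open>(v, e, -, -, \<lambda> : r \<times> c)\<close> adjusted orthogonal array on the symbol set \<open>V\<close>.  The dashes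
  stand for the unconstrained numbers of common symbols of two rows and of two columns.\<close>

definition ao_array ::
  "'a set \<Rightarrow> nat \<Rightarrow> nat \<Rightarrow> nat \<Rightarrow> nat \<Rightarrow> nat \<Rightarrow> (nat \<Rightarrow> nat \<Rightarrow> 'a) \<Rightarrow> bool" where
  "ao_array V v e lam r c A \<longleftrightarrow>
     finite V \<and> card V = v \<and>
     (\<forall>i\<in>{1..r}. \<forall>j\<in>{1..c}. A i j \<in> V) \<and>
     (\<forall>i\<in>{1..r}. inj_on (\<lambda>j. A i j) {1..c}) \<and>
     (\<forall>j\<in>{1..c}. inj_on (\<lambda>i. A i j) {1..r}) \<and>
     (\<forall>s\<in>V. card {(i, j). i \<in> {1..r} \<and> j \<in> {1..c} \<and> A i j = s} = e) \<and>
     (\<forall>i\<in>{1..r}. \<forall>j\<in>{1..c}. card ((\<lambda>j'. A i j') ` {1..c} \<inter> (\<lambda>i'. A i' j) ` {1..r}) = lam)"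

text \<open>Integers are used since the left end \<open>(i - 1) k - (i - 2)\<close> involves \<open>-1\<close> for \<open>i = 1\<close>.\<close>

definition primed_position :: "nat \<Rightarrow> nat \<Rightarrow> nat \<Rightarrow> bool" where
  "primed_position k i j \<longleftrightarrow>
     (\<exists>p \<in> {(int i - 1) * int k - (int i - 2) .. int i * int k - (int i - 1)}.
        [int j = p] (mod (2 * int k)))"

text \<open>\<open>Inl s\<close> is the old symbol \<open>s\<close>, and \<open>Inr s\<close> is the new symbol \<open>s'\<close>.\<close>

definition prime_symbols :: "nat \<Rightarrow> (nat \<Rightarrow> nat \<Rightarrow> 'a) \<Rightarrow> nat \<Rightarrow> nat \<Rightarrow> 'a + 'a" where
  "prime_symbols k L i j = (if primed_position k i j then Inr (L i j) else Inl (L i j))"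

end

theory Submission
  imports Defs
begin

text \<open>Number rows, columns and group elements from \<open>0\<close>, so that cell \<open>(r, c)\<close> holds the symbol of
  \<open>m = (r + c) mod 2k\<close>. The primed positions of row \<open>r\<close> are \<open>c \<equiv> r k - r + t\<close> with \<open>0 \<le> t < k\<close>,
  that is \<open>m \<equiv> r k + t\<close>: row \<open>r\<close> primes the symbols \<open>m < k\<close> if \<open>r\<close> is even, and the symbols
  \<open>m \<ge> k\<close> if \<open>r\<close> is odd. So each version of a symbol occupies the \<open>k\<close> rows of one parity.
  The symbol \<open>m\<close> of column \<open>c\<close> lies in row \<open>m - c\<close>, hence it has the same version in row \<open>r\<close> iff
  \<open>m - c\<close> and \<open>r\<close> have equal parity, which holds for \<open>k\<close> of the \<open>2k\<close> values of \<open>m\<close>.\<close>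

lemma card_parity_class_lessThan: "card {m \<in> {..<2 * k}. even m = P} = k"
proof (induction k)
  case (Suc k)
  have "{m \<in> {..<2 * Suc k}. even m = P}
      = insert (if P then 2 * k else Suc (2 * k)) {m \<in> {..<2 * k}. even m = P}"
    by (cases P) (auto simp: less_Suc_eq)
  with Suc show ?case by (subst \<open>_ = insert _ _\<close>, subst card_insert_disjoint) auto
qed simp

lemma card_parity_class_atLeastAtMost: "card {i \<in> {1..2 * k}. even i = P} = k"
proof -
  have "{i \<in> {1..2 * k}. even i = P} = Suc ` {m \<in> {..<2 * k}. even m = (\<not> P)}"
    by (auto simp: image_iff Bex_def gr0_conv_Suc Suc_le_eq)
  then show ?thesis
    using card_parity_class_lessThan[of k "\<not> P"] by (simp only: card_image inj_Suc)
qed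

text \<open>Cancelling \<open>i - 1\<close> modulo \<open>n\<close> gives injectivity, and an
  injection between two sets of size \<open>n\<close> is onto. The truncated
  \<open>i + j - 2\<close> equals \<open>(i - 1) + (j - 1)\<close> only because both indices start
  at 1. By commutativity of addition this serves columns as well as rows.\<close>

lemma bij_betw_add_mod:
  fixes i n :: nat
  assumes "i \<ge> 1"
  shows "bij_betw (\<lambda>j. (i + j - 2) mod n) {1..n} {..<n}"
proof -
  have inj: "inj_on (\<lambda>j. (i + j - 2) mod n) {1..n}"
  proof (rule inj_onI)
    fix j j' assume j: "j \<in> {1..n}" "j' \<in> {1..n}" and eq: "(i + j - 2) mod n = (i + j' - 2) mod n"
    have "i + j - 2 = (i - 1) + (j - 1)" "i + j' - 2 = (i - 1) + (j' - 1)"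
      using assms j by auto
    with eq have "[(i - 1) + (j - 1) = (i - 1) + (j' - 1)] (mod n)"
      by (simp add: cong_def)
    then have "[j - 1 = j' - 1] (mod n)"
      by (simp only: cong_add_lcancel_nat)
    with j have "j - 1 = j' - 1"
      by (intro cong_less_modulus_unique_nat) auto
    with j show "j = j'" by auto
  qed
  have "(\<lambda>j. (i + j - 2) mod n) ` {1..n} = {..<n}"
    using card_image[OF inj] by (intro card_subset_eq) auto
  with inj show ?thesis by (simp add: bij_betw_def)
qed

lemma even_mod_double_iff: "even (x mod (2 * k)) \<longleftrightarrow> even (x :: nat)"
  by (metis dvd_mod_iff dvd_triv_left)

text \<open>Adding \<open>i - 2\<close> to both sides of the congruence turns the position
  \<open>j\<close> into \<open>i + j - 2\<close> and the left end of the window into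
  \<open>(i - 1) k\<close>. Modulo \<open>2 k\<close> this is 0 for odd \<open>i\<close> and
  \<open>k\<close> for even \<open>i\<close>, so the window becomes the lower or the upper half of
  the residues. Parities look opposite to those in the overview because rows are numbered from 1
  here.\<close>

lemma primed_position_iff:
  assumes "k > 0" "i \<ge> 1" "j \<ge> 1"
  shows "primed_position k i j \<longleftrightarrow> (odd i \<longleftrightarrow> (i + j - 2) mod (2 * k) < k)"
proof -
  define m where "m = (int i + int j - 2) mod (2 * int k)"
  have m_range: "0 \<le> m" "m < 2 * int k" using assms by (auto simp: m_def)
  have m_nat: "m = int ((i + j - 2) mod (2 * k))"
    using assms by (simp add: m_def zmod_int of_nat_diff)
  \<comment> \<open>The two ends of the window differ by \<open>k - 1\<close>, so \<open>t\<close>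
    is the offset from the left end.\<close>
  have "primed_position k i j \<longleftrightarrow>
      (\<exists>t\<in>{0..<int k}. [int j = (int i - 1) * int k - (int i - 2) + t] (mod (2 * int k)))"
    (is "_ \<longleftrightarrow> (\<exists>t\<in>_. ?C t)")
  proof
    assume "primed_position k i j"
    then obtain p where p: "(int i - 1) * int k - (int i - 2) \<le> p" "p \<le> int i * int k - (int i - 1)"
      "[int j = p] (mod (2 * int k))" by (auto simp: primed_position_def)
    then show "\<exists>t\<in>{0..<int k}. ?C t"
      by (intro bexI[of _ "p - ((int i - 1) * int k - (int i - 2))"]) (auto simp: algebra_simps)
  next
    assume "\<exists>t\<in>{0..<int k}. ?C t"
    then obtain t where "0 \<le> t" "t < int k" "?C t" by auto
    then show "primed_position k i j"
      unfolding primed_position_def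
      by (intro bexI[of _ "(int i - 1) * int k - (int i - 2) + t"]) (auto simp: algebra_simps)
  qed
  also have "\<dots> \<longleftrightarrow> (\<exists>t\<in>{0..<int k}. m = ((int i - 1) * int k + t) mod (2 * int k))"
  proof -
    have "?C t \<longleftrightarrow> m = ((int i - 1) * int k + t) mod (2 * int k)" for t
    proof -
      have "?C t \<longleftrightarrow> [int i + int j - 2 = (int i - 1) * int k + t] (mod (2 * int k))"
        by (simp add: cong_iff_dvd_diff algebra_simps)
      then show ?thesis by (simp add: m_def cong_def)
    qed
    then show ?thesis by simp
  qed
  also have "\<dots> \<longleftrightarrow> (\<exists>t\<in>{0..<int k}. m = (if odd i then t else int k + t))"
  proof (intro bex_cong refl)
    fix t assume "t \<in> {0..<int k}"
    then have t: "0 \<le> t" "t < int k" by auto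
    have "((int i - 1) * int k + t) mod (2 * int k) = (if odd i then t else int k + t)"
    proof (cases "odd i")
      case True
      then obtain q where "i = 2 * q + 1" by (auto elim: oddE)
      then have "(int i - 1) * int k + t = t + int q * (2 * int k)" by simp
      with True t show ?thesis by (simp only: mod_mult_self1) simp
    next
      case False
      then obtain q where "i = 2 * q" by auto
      then have "(int i - 1) * int k + t = (int k + t) + (int q - 1) * (2 * int k)"
        by (simp add: algebra_simps)
      with False t show ?thesis by (simp only: mod_mult_self1) simp
    qed
    then show "m = ((int i - 1) * int k + t) mod (2 * int k) \<longleftrightarrow>
        m = (if odd i then t else int k + t)" by simp
  qed
  also have "\<dots> \<longleftrightarrow> (odd i \<longleftrightarrow> m < int k)"
  proof (cases "odd i")
    case False
    have "(\<exists>t\<in>{0..<int k}. m = int k + t) \<longleftrightarrow> \<not> m < int k"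
      using m_range by (auto intro!: bexI[of _ "m - int k"])
    with False show ?thesis by simp
  qed (use m_range in auto)
  finally show ?thesis by (simp only: m_nat of_nat_less_iff)
qed

text \<open>Both headings list the powers of one element \<open>a\<close>, so an entry depends only
  on the exponent \<open>(i - 1) + (j - 1)\<close>, which may be reduced modulo the group order. The
  map \<psi> names each power of \<open>a\<close> by its exponent.\<close>

lemma cyclic_latin_square_symbols:
  assumes "n > 0" "cyclic_latin_square n S L"
  obtains \<psi> where "bij_betw \<psi> {..<n} S"
    "\<And>i j. i \<in> {1..n} \<Longrightarrow> j \<in> {1..n} \<Longrightarrow> L i j = \<psi> ((i + j - 2) mod n)"
proof -
  let ?G = "integer_mod_group n"
  from assms(2) obtain a \<phi> where a: "a \<in> carrier ?G" and
    tab: "group_table ?G n S (\<lambda>i. a [^]\<^bsub>?G\<^esub> (i - 1)) (\<lambda>j. a [^]\<^bsub>?G\<^esub> (j - 1)) \<phi> L"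
    by (auto simp: cyclic_latin_square_def)
  define \<psi> where "\<psi> m = \<phi> (a [^]\<^bsub>?G\<^esub> m)" for m :: nat
  \<comment> \<open>The row headings, re-indexed by their exponents, show that the exponents below
    \<open>n\<close> reach every group element exactly once.\<close>
  have "bij_betw (\<lambda>m. m + 1) {..<n} {1..n}"
    by (rule bij_betw_byWitness[where f' = "\<lambda>i. i - 1"]) auto
  from bij_betw_trans[OF this] tab have "bij_betw (\<lambda>m. a [^]\<^bsub>?G\<^esub> m) {..<n} (carrier ?G)"
    by (fastforce simp: group_table_def o_def)
  then have "bij_betw \<psi> {..<n} S"
    using bij_betw_trans tab unfolding group_table_def \<psi>_def by (fastforce simp: o_def)
  moreover have "L i j = \<psi> ((i + j - 2) mod n)" if "i \<in> {1..n}" "j \<in> {1..n}" for i j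
  proof -
    have "i - 1 + (j - 1) = i + j - 2" using that by auto
    then have "a [^]\<^bsub>?G\<^esub> (i - 1) \<otimes>\<^bsub>?G\<^esub> a [^]\<^bsub>?G\<^esub> (j - 1) = a [^]\<^bsub>?G\<^esub> (i + j - 2)"
      using monoid.nat_pow_mult[OF group.is_monoid[OF group_integer_mod_group] a]
      by (simp only:)
    also have "\<dots> = a [^]\<^bsub>?G\<^esub> ((i + j - 2) mod n)"
      using \<open>n > 0\<close> by (simp add: pow_integer_mod_group zmod_int mod_mult_left_eq)
    finally show ?thesis using tab that by (simp add: group_table_def \<psi>_def)
  qed
  ultimately show thesis using that by blast
qed

theorem theorem4p7:
  fixes k :: nat and L :: "nat \<Rightarrow> nat \<Rightarrow> nat"
  assumes "k > 0"
    and "cyclic_latin_square (2 * k) {1..2 * k} L"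
  shows "ao_array ({1..2 * k} <+> {1..2 * k}) (4 * k) k k (2 * k) (2 * k) (prime_symbols k L)"
proof -
  define n where "n = 2 * k"
  have "n > 0" using assms by (simp add: n_def)
  obtain \<psi> where \<psi>: "bij_betw \<psi> {..<n} {1..n}"
    and L: "\<And>i j. i \<in> {1..n} \<Longrightarrow> j \<in> {1..n} \<Longrightarrow> L i j = \<psi> ((i + j - 2) mod n)"
    using cyclic_latin_square_symbols[of n "{1..n}" L] assms by (auto simp: n_def)
  have \<psi>_eq: "\<psi> m = \<psi> m' \<longleftrightarrow> m = m'" if "m < n" "m' < n" for m m'
    using \<psi> that by (auto simp: bij_betw_def inj_on_def)
  have \<psi>_mem: "\<psi> m \<in> {1..n}" if "m < n" for m
    using \<psi> that by (auto simp: bij_betw_def)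
  \<comment> \<open>The version of a symbol depends on the row only through its parity. Since
    \<open>B\<close> accepts any natural number as row, a number of the right parity can replace the
    row, even if it lies outside \<open>{1..n}\<close>.\<close>
  define B where "B i m = (if odd i \<longleftrightarrow> m < k then Inr (\<psi> m) else Inl (\<psi> m))" for i m :: nat
  have B_eq: "B i m = B i' m' \<longleftrightarrow> m = m' \<and> even i = even i'" if "m < n" "m' < n" for i i' m m'
    using that by (auto simp: B_def \<psi>_eq)
  have B_parity: "B i m = B i' m" if "even i = even i'" for i i' m
    using that by (simp add: B_def)
  have A: "prime_symbols k L i j = B i ((i + j - 2) mod n)" if "i \<in> {1..n}" "j \<in> {1..n}" for i j
    using that assms(1) primed_position_iff[of k i j] L[OF that]
    by (simp add: prime_symbols_def B_def n_def)
  have mod_less: "x mod n < n" for x using \<open>n > 0\<close> by simp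
  have cols: "bij_betw (\<lambda>j. (i + j - 2) mod n) {1..n} {..<n}" if "i \<in> {1..n}" for i
    using that by (intro bij_betw_add_mod) auto
  have rows: "bij_betw (\<lambda>i. (i + j - 2) mod n) {1..n} {..<n}" if "j \<in> {1..n}" for j
    using cols[OF that] by (simp only: add.commute)

  have "prime_symbols k L i j \<in> {1..n} <+> {1..n}" if "i \<in> {1..n}" "j \<in> {1..n}" for i j
    using \<psi>_mem[OF mod_less] by (simp add: A[OF that] B_def InlI InrI)
  moreover have "inj_on (\<lambda>j. prime_symbols k L i j) {1..n}" if "i \<in> {1..n}" for i
    by (intro inj_onI, rule inj_onD[OF bij_betw_imp_inj_on[OF cols[OF that]]])
      (simp_all add: A[OF that] B_eq mod_less)
  moreover have "inj_on (\<lambda>i. prime_symbols k L i j) {1..n}" if "j \<in> {1..n}" for j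
    by (intro inj_onI, rule inj_onD[OF bij_betw_imp_inj_on[OF rows[OF that]]])
      (simp_all add: A[OF _ that] B_eq mod_less)
  moreover have "card {(i, j). i \<in> {1..n} \<and> j \<in> {1..n} \<and> prime_symbols k L i j = s} = k"
    if s: "s \<in> {1..n} <+> {1..n}" for s
  proof -
    obtain i\<^sub>0 m where m: "m < n" "s = B i\<^sub>0 m"
    proof -
      from s obtain x where x: "x \<in> {1..n}" "s = Inl x \<or> s = Inr x" by auto
      then have "x \<in> \<psi> ` {..<n}" using \<psi> by (simp add: bij_betw_def)
      then obtain m where "m < n" "x = \<psi> m" by auto
      \<comment> \<open>0 and 1 merely represent the two parities: one yields the old symbol and the
        other the new one.\<close>
      then have "s = B 0 m \<or> s = B 1 m" using x(2) by (auto simp: B_def)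
      with \<open>m < n\<close> show thesis using that by blast
    qed
    let ?P = "{(i, j). i \<in> {1..n} \<and> j \<in> {1..n} \<and> prime_symbols k L i j = s}"
    have P: "?P = {(i, j). i \<in> {1..n} \<and> j \<in> {1..n} \<and> (i + j - 2) mod n = m \<and> even i = even i\<^sub>0}"
      using m by (auto simp: A B_eq mod_less)
    \<comment> \<open>A row and a symbol determine the column, so occurrences of \<open>s\<close>
      are counted by their rows.\<close>
    have inj_fst: "inj_on fst ?P"
    proof (rule inj_onI)
      fix p q assume pq: "p \<in> ?P" "q \<in> ?P" "fst p = fst q"
      obtain i j j' where "p = (i, j)" "q = (i, j')" using pq(3) by (metis prod.collapse)
      with pq show "p = q"
        using inj_onD[OF bij_betw_imp_inj_on[OF cols[of i]], of j j'] unfolding P by simp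
    qed
    have "fst ` ?P = {i \<in> {1..n}. even i = even i\<^sub>0}"
    proof
      show "{i \<in> {1..n}. even i = even i\<^sub>0} \<subseteq> fst ` ?P"
      proof
        fix i assume i: "i \<in> {i \<in> {1..n}. even i = even i\<^sub>0}"
        then have "m \<in> (\<lambda>j. (i + j - 2) mod n) ` {1..n}"
          using bij_betw_imp_surj_on[OF cols[of i]] \<open>m < n\<close> by simp
        then obtain j where "j \<in> {1..n}" "(i + j - 2) mod n = m" by auto
        with i have "(i, j) \<in> ?P" unfolding P by simp
        then show "i \<in> fst ` ?P" by (rule image_eqI[rotated]) simp
      qed
    qed (unfold P, auto)
    then have "card (fst ` ?P) = k" by (simp only: card_parity_class_atLeastAtMost n_def)
    with inj_fst show ?thesis by (simp only: card_image)
  qed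
  moreover have "card ((\<lambda>j'. prime_symbols k L i j') ` {1..n} \<inter> (\<lambda>i'. prime_symbols k L i' j) ` {1..n}) = k"
    if i: "i \<in> {1..n}" and j: "j \<in> {1..n}" for i j
  proof -
    have "(\<lambda>j'. prime_symbols k L i j') ` {1..n} = B i ` (\<lambda>j'. (i + j' - 2) mod n) ` {1..n}"
      using i by (simp add: image_image A)
    then have row: "(\<lambda>j'. prime_symbols k L i j') ` {1..n} = B i ` {..<n}"
      using bij_betw_imp_surj_on[OF cols[OF i]] by simp
    \<comment> \<open>The row in which column \<open>j\<close> holds \<open>m\<close> is congruent
      to \<open>m - j + 2\<close> modulo the even number \<open>n\<close>, so it has the parity of
      \<open>m + j\<close>. This describes the column by \<open>m\<close> alone, without
      subtraction.\<close>
    have "prime_symbols k L i' j = B ((i' + j - 2) mod n + j) ((i' + j - 2) mod n)"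
      if "i' \<in> {1..n}" for i'
    proof -
      \<comment> \<open>The extra 2 keeps the parity and undoes the truncated subtraction.\<close>
      have "even ((i' + j - 2) mod n + j) = even (i' + j - 2 + 2 + j)"
        by (simp add: n_def even_mod_double_iff)
      also have "i' + j - 2 + 2 + j = i' + 2 * j" using that j by auto
      finally have "even i' = even ((i' + j - 2) mod n + j)" by simp
      then show ?thesis unfolding A[OF that j] by (rule B_parity)
    qed
    then have "(\<lambda>i'. prime_symbols k L i' j) ` {1..n}
        = (\<lambda>m. B (m + j) m) ` (\<lambda>i'. (i' + j - 2) mod n) ` {1..n}"
      unfolding image_image by (rule image_cong[OF refl])
    then have col: "(\<lambda>i'. prime_symbols k L i' j) ` {1..n} = (\<lambda>m. B (m + j) m) ` {..<n}"
      using bij_betw_imp_surj_on[OF rows[OF j]] by simp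
    \<comment> \<open>By \<open>B_eq\<close> a common symbol comes from the same \<open>m\<close> on
      both sides, and the versions agree iff \<open>i\<close> and \<open>m + j\<close> have equal
      parity. That fixes the parity of \<open>m\<close>.\<close>
    have "B i ` {..<n} \<inter> (\<lambda>m. B (m + j) m) ` {..<n} = B i ` {m \<in> {..<n}. even m = even (i + j)}"
      (is "_ = B i ` ?M")
    proof (intro equalityI subsetI)
      fix s assume "s \<in> B i ` {..<n} \<inter> (\<lambda>m. B (m + j) m) ` {..<n}"
      then show "s \<in> B i ` ?M" by (auto simp: B_eq)
    next
      fix s assume "s \<in> B i ` ?M"
      then obtain m where m: "m \<in> ?M" "s = B i m" by auto
      then have "s = B (m + j) m" using B_parity[of i "m + j" m] by auto
      with m show "s \<in> B i ` {..<n} \<inter> (\<lambda>m. B (m + j) m) ` {..<n}" by blast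
    qed
    moreover have "inj_on (B i) ?M" by (auto simp: inj_on_def B_eq)
    ultimately show ?thesis
      unfolding row col using card_parity_class_lessThan[of k "even (i + j)"]
      by (simp only: card_image n_def)
  qed
  moreover have "finite ({1..n} <+> {1..n})" "card ({1..n} <+> {1..n}) = 4 * k"
    by (simp_all add: card_Plus n_def)
  ultimately show ?thesis
    unfolding ao_array_def n_def[symmetric] by (intro conjI ballI)
qed

end
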